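(* Let $G$ be a connected graph of order $n\geq 4$ with maximum degree $\Delta(G)$, and let $C(G)$ be its central graph. Then $D(C(G))\leq \lceil \sqrt{\Delta(G)}\rceil$.
   Context: All graphs are simple, finite, undirected. The central graph $C(G)$ of $G$ has vertex set $V(G)\cup\{w_{u,v}:\{u,v\}\in E(G)\}$ (one new vertex $w_{u,v}$ for each edge of $G$), and edge set consisting of all pairs $\{u,v\}$ with $u\neq v\in V(G)$ and $\{u,v\}\notin E(G)$, together with the edges $\{u,w_{u,v}\}$ and $\{w_{u,v},v\}$ for every $\{u,v\}\in E(G)$. An automorphism $\phi$ of a graph $H$ preserves a vertex coloring $f$ (not necessarily proper) if $f(\phi(x))=f(x)$ for all vertices $x$. The distinguishing number $D(H)$ is the least integer $d$ such that $H$ has a vertex coloring with $d$ colors preserved only by the identity automorphism. *)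

theory Defs
  imports Complex_Main "Graph_Theory.Graph_Theory"
begin

text \<open>
  A finite simple undirected graph is a \<^locale>\<open>pair_graph\<close>: finitely many vertices, and a finite
  symmetric irreflexive arc relation on them, so that an undirected edge \<open>{u, v}\<close> is the pair of
  arcs \<open>(u, v)\<close>, \<open>(v, u)\<close>.
\<close>

text \<open>By symmetry of the arcs, the out-degree of a vertex is its number of neighbours.\<close>

definition max_degree :: "'a pair_pre_digraph \<Rightarrow> nat" where
  "max_degree G = Max (out_degree (with_proj G) ` pverts G)"


text \<open>
  The new vertex \<open>w\<^sub>u\<^sub>,\<^sub>v\<close> belongs to the undirected edge, hence it is indexed by the
  set \<open>{u, v}\<close> and is shared by the arcs \<open>(u, v)\<close> and \<open>(v, u)\<close>.
\<close>

datatype 'a central_vertex = Orig 'a | Mid "'a set"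

definition central_graph :: "'a pair_pre_digraph \<Rightarrow> 'a central_vertex pair_pre_digraph" where
  "central_graph G =
     \<lparr> pverts = Orig ` pverts G \<union> {Mid {u, v} | u v. (u, v) \<in> parcs G},
       parcs =
         {(Orig u, Orig v) | u v. u \<in> pverts G \<and> v \<in> pverts G \<and> u \<noteq> v \<and> (u, v) \<notin> parcs G}
         \<union> {(Orig u, Mid {u, v}) | u v. (u, v) \<in> parcs G}
         \<union> {(Mid {u, v}, Orig v) | u v. (u, v) \<in> parcs G} \<rparr>"

lemma pair_graph_central_graph:
  assumes "pair_graph G"
  shows "pair_graph (central_graph G)"
proof -
  interpret pair_graph G by fact
  have sym: "(v, u) \<in> parcs G" if "(u, v) \<in> parcs G" for u v
    using that pair_sym_arcs by (auto simp: symmetric_def sym_def)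
  let ?V = "pverts (central_graph G)" and ?A = "parcs (central_graph G)"
  have V: "?V = Orig ` pverts G \<union> (\<lambda>(u, v). Mid {u, v}) ` parcs G"
    by (auto simp: central_graph_def)
  have fin: "finite ?V"
    using pair_finite_verts pair_finite_arcs by (simp add: V)
  have sub: "?A \<subseteq> ?V \<times> ?V"
    by (auto simp: central_graph_def dest: in_arcsD1 in_arcsD2)
  have "symmetric (with_proj (central_graph G))"
    unfolding symmetric_def with_proj_simps sym_def central_graph_def
    by (auto simp: insert_commute dest: sym)
  moreover have "finite ?A"
    using finite_subset[OF sub] fin by simp
  moreover have "fst e \<noteq> snd e" if "e \<in> ?A" for e
    using that by (auto simp: central_graph_def)
  moreover have "fst e \<in> ?V" "snd e \<in> ?V" if "e \<in> ?A" for e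
    using subsetD[OF sub that] by (simp_all only: mem_Times_iff)
  ultimately show ?thesis
    using fin by unfold_locales
qed


definition automorphism :: "'a pair_pre_digraph \<Rightarrow> ('a \<Rightarrow> 'a) \<Rightarrow> bool" where
  "automorphism H \<phi> \<longleftrightarrow>
     bij_betw \<phi> (pverts H) (pverts H) \<and>
     (\<forall>x\<in>pverts H. \<forall>y\<in>pverts H. (\<phi> x, \<phi> y) \<in> parcs H \<longleftrightarrow> (x, y) \<in> parcs H)"

text \<open>
  These are the vertex parts of the isomorphisms of \<^term>\<open>with_proj H\<close> onto itself in the sense
  of \<^const>\<open>pre_digraph.digraph_isomorphism\<close>, whose arc part is redundant here.
\<close>

lemma automorphism_iff_digraph_isomorphism:
  assumes "pair_wf_digraph H"
  shows "automorphism H \<phi> \<longleftrightarrow>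
    (\<exists>hom. pre_digraph.digraph_isomorphism (with_proj H) hom \<and>
      app_iso hom (with_proj H) = with_proj H \<and> iso_verts hom = \<phi>)"
proof
  interpret pair_wf_digraph H by fact
  assume aut: "automorphism H \<phi>"
  then have inj: "inj_on \<phi> (pverts H)" and surj: "\<phi> ` pverts H = pverts H"
    and arc: "\<And>x y. x \<in> pverts H \<Longrightarrow> y \<in> pverts H \<Longrightarrow> (\<phi> x, \<phi> y) \<in> parcs H \<longleftrightarrow> (x, y) \<in> parcs H"
    by (auto simp: automorphism_def bij_betw_def)
  let ?hom = "\<lparr> iso_verts = \<phi>, iso_arcs = map_prod \<phi> \<phi>, iso_head = snd, iso_tail = fst \<rparr>"
  have "map_prod \<phi> \<phi> ` parcs H = parcs H"
  proof (intro equalityI subrelI)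
    fix a b assume ab: "(a, b) \<in> parcs H"
    then obtain x y where "x \<in> pverts H" "y \<in> pverts H" "a = \<phi> x" "b = \<phi> y"
      using surj in_arcsD1 in_arcsD2 by (metis imageE)
    then show "(a, b) \<in> map_prod \<phi> \<phi> ` parcs H"
      using ab arc by force
  qed (use arc in_arcsD1 in_arcsD2 in force)
  moreover have "inj_on (map_prod \<phi> \<phi>) (parcs H)"
  proof (rule inj_on_subset[OF map_prod_inj_on[OF inj inj]])
    show "parcs H \<subseteq> pverts H \<times> pverts H"
      by (auto dest: in_arcsD1 in_arcsD2)
  qed
  moreover have "wf_digraph (with_proj H)"
    by unfold_locales
  ultimately have "pre_digraph.digraph_isomorphism (with_proj H) ?hom \<and>
      app_iso ?hom (with_proj H) = with_proj H \<and> iso_verts ?hom = \<phi>"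
    using inj surj by (auto simp: pre_digraph.digraph_isomorphism_def app_iso_def with_proj_def)
  then show "\<exists>hom. pre_digraph.digraph_isomorphism (with_proj H) hom \<and>
      app_iso hom (with_proj H) = with_proj H \<and> iso_verts hom = \<phi>" by blast
next
  interpret pair_wf_digraph H by fact
  assume "\<exists>hom. pre_digraph.digraph_isomorphism (with_proj H) hom \<and>
      app_iso hom (with_proj H) = with_proj H \<and> iso_verts hom = \<phi>"
  then obtain hom where hom: "pre_digraph.digraph_isomorphism (with_proj H) hom"
      "app_iso hom (with_proj H) = with_proj H" "iso_verts hom = \<phi>" by blast
  have inj: "inj_on \<phi> (pverts H)" and surj: "\<phi> ` pverts H = pverts H"
    and arcs: "iso_arcs hom ` parcs H = parcs H"
    using hom by (auto simp: pre_digraph.digraph_isomorphism_def app_iso_def with_proj_def)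
  have "iso_tail hom = fst" "iso_head hom = snd"
    using hom(2) by (auto simp: app_iso_def with_proj_def)
  then have "iso_arcs hom e = map_prod \<phi> \<phi> e" if "e \<in> parcs H" for e
    using hom(1,3) that by (auto simp: pre_digraph.digraph_isomorphism_def prod_eq_iff)
  then have img: "map_prod \<phi> \<phi> ` parcs H = parcs H"
    using arcs by (metis (no_types, lifting) image_cong)
  have "(\<phi> x, \<phi> y) \<in> parcs H \<longleftrightarrow> (x, y) \<in> parcs H" if "x \<in> pverts H" "y \<in> pverts H" for x y
  proof
    assume "(\<phi> x, \<phi> y) \<in> parcs H"
    then have "(\<phi> x, \<phi> y) \<in> map_prod \<phi> \<phi> ` parcs H"
      by (simp only: img)
    then obtain u v where uv: "(u, v) \<in> parcs H" "\<phi> u = \<phi> x" "\<phi> v = \<phi> y"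
      by auto
    have "u = x"
      by (rule inj_onD[OF inj uv(2) in_arcsD1[OF uv(1)] that(1)])
    moreover have "v = y"
      by (rule inj_onD[OF inj uv(3) in_arcsD2[OF uv(1)] that(2)])
    ultimately show "(x, y) \<in> parcs H"
      using uv(1) by simp
  next
    assume "(x, y) \<in> parcs H"
    then have "map_prod \<phi> \<phi> (x, y) \<in> map_prod \<phi> \<phi> ` parcs H"
      by (rule imageI)
    then show "(\<phi> x, \<phi> y) \<in> parcs H"
      by (simp only: img map_prod_simp)
  qed
  then show "automorphism H \<phi>"
    using inj surj by (simp add: automorphism_def bij_betw_def)
qed

definition preserves_coloring :: "'a pair_pre_digraph \<Rightarrow> ('a \<Rightarrow> 'c) \<Rightarrow> ('a \<Rightarrow> 'a) \<Rightarrow> bool" where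
  "preserves_coloring H f \<phi> \<longleftrightarrow> (\<forall>x\<in>pverts H. f (\<phi> x) = f x)"

text \<open>
  The colors are \<open>0, \<dots>, d - 1\<close>; not all of them need to be used. Maps are total functions in HOL,
  so being the identity is required on the vertices only.
\<close>

definition distinguishing_coloring :: "'a pair_pre_digraph \<Rightarrow> nat \<Rightarrow> ('a \<Rightarrow> nat) \<Rightarrow> bool" where
  "distinguishing_coloring H d f \<longleftrightarrow>
     (\<forall>x\<in>pverts H. f x < d) \<and>
     (\<forall>\<phi>. automorphism H \<phi> \<and> preserves_coloring H f \<phi> \<longrightarrow> (\<forall>x\<in>pverts H. \<phi> x = x))"

definition distinguishing_number :: "'a pair_pre_digraph \<Rightarrow> nat" where
  "distinguishing_number H = (LEAST d. \<exists>f. distinguishing_coloring H d f)"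

text \<open>The minimum in \<^const>\<open>distinguishing_number\<close> is attained for finite graphs.\<close>

lemma distinguishing_coloring_exists:
  assumes "finite (pverts H)"
  shows "\<exists>d f. distinguishing_coloring H d f"
proof -
  obtain f :: "'a \<Rightarrow> nat" and n where f: "f ` pverts H = {i. i < n}" "inj_on f (pverts H)"
    using finite_imp_inj_to_nat_seg[OF assms] by blast
  have "\<phi> x = x" if "automorphism H \<phi>" "preserves_coloring H f \<phi>" "x \<in> pverts H" for \<phi> x
  proof -
    have "\<phi> x \<in> pverts H"
      using that by (auto simp: automorphism_def bij_betw_def)
    then show ?thesis
      using that f(2) by (auto simp: preserves_coloring_def dest: inj_onD)
  qed
  then have "distinguishing_coloring H n f"
    using f(1) by (auto simp: distinguishing_coloring_def)
  then show ?thesis by blast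
qed

end

theory Submission
  imports Defs
begin

text \<open>
  The vertices of \<open>G\<close> have degree \<open>n - 1 \<ge> 3\<close> in \<open>C(G)\<close> and the new ones degree 2, so automorphisms
  of \<open>C(G)\<close> come from automorphisms of \<open>G\<close>, and colorings of \<open>C(G)\<close> are total colorings of \<open>G\<close>.
  Take a spanning search tree of \<open>G\<close> rooted at a vertex \<open>r\<close> of maximum degree \<open>\<Delta> \<le> d\<^sup>2\<close>, and give the
  children of each vertex pairwise distinct pairs (color of the tree edge, color of the child)
  among the \<open>d\<^sup>2\<close> possible ones; once \<open>r\<close> is known to be fixed, all vertices are fixed one after the
  other in search order. To fix \<open>r\<close>, give all non-tree edges color 0 and let \<open>r\<close> have as few edges of
  color 0 as possible, say \<open>a\<close> of them. A vertex other than \<open>r\<close> has fewer than \<open>d\<^sup>2\<close> children, so if it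
  has any, the number of color-0 edges to them can take two different values, one of which
  makes its total number of color-0 edges different from \<open>a\<close>; a leaf of the tree with degree \<open>\<Delta>\<close> has
  at least \<open>\<Delta> - 1 > a\<close> such edges.
\<close>

section \<open>Search orders of a connected graph\<close>

lemma search_order_exists:
  assumes fin: "finite V" and r: "r \<in> V"
    and conn: "\<And>S. S \<subset> V \<Longrightarrow> r \<in> S \<Longrightarrow> \<exists>x\<in>S. \<exists>y\<in>V - S. (x, y) \<in> E"
  obtains rk :: "'a \<Rightarrow> nat" where "inj_on rk V" "rk r = 0"
    "\<And>y. y \<in> V \<Longrightarrow> y \<noteq> r \<Longrightarrow> \<exists>x\<in>V. (x, y) \<in> E \<and> rk x < rk y"
proof -
  have "\<exists>S rk. S \<subseteq> V \<and> r \<in> S \<and> card S = Suc n \<and> inj_on rk S \<and> rk ` S \<subseteq> {..n} \<and> rk r = 0 \<and>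
      (\<forall>y\<in>S - {r}. \<exists>x\<in>S. (x, y) \<in> E \<and> rk x < rk y)" if "n < card V" for n
    using that
  proof (induction n)
    case 0
    then show ?case
      using r by (intro exI[of _ "{r}"] exI[of _ "\<lambda>_. 0"]) auto
  next
    case (Suc n)
    then obtain S and rk :: "'a \<Rightarrow> nat" where S: "S \<subseteq> V" "r \<in> S" "card S = Suc n" "inj_on rk S"
        "rk ` S \<subseteq> {..n}" "rk r = 0" "\<forall>y\<in>S - {r}. \<exists>x\<in>S. (x, y) \<in> E \<and> rk x < rk y"
      by (meson Suc_lessD)
    have "S \<subset> V"
      using S(1,3) Suc.prems by auto
    then obtain x y where xy: "x \<in> S" "y \<in> V" "y \<notin> S" "(x, y) \<in> E"
      using conn S(2) by blast
    have lt: "rk z < Suc n" if "z \<in> S" for z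
      using S(5) that by (auto simp: less_Suc_eq_le)
    let ?rk = "rk(y := Suc n)"
    have "?rk z = rk z" if "z \<in> S" for z
      using that xy(3) by auto
    then have "inj_on ?rk (insert y S)"
      using S(4) lt by (fastforce simp: inj_on_def)
    moreover have "\<exists>x\<in>insert y S. (x, z) \<in> E \<and> ?rk x < ?rk z" if z: "z \<in> insert y S - {r}" for z
    proof (cases "z = y")
      case True
      then show ?thesis
        using xy lt by (intro bexI[of _ x]) auto
    next
      case False
      then obtain w where "w \<in> S" "(w, z) \<in> E" "rk w < rk z"
        using z S(7) by blast
      then show ?thesis
        using False xy(3) by (intro bexI[of _ w]) auto
    qed
    moreover have "card (insert y S) = Suc (Suc n)"
      using S(1,3) xy(3) fin finite_subset by fastforce
    moreover have "?rk ` insert y S \<subseteq> {..Suc n}"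
      using S(5) by auto
    ultimately show ?case
      using S(1,2,6) xy(2,3)
      by (intro exI[of _ "insert y S"] exI[of _ ?rk] conjI ballI) (assumption | force)+
  qed
  moreover obtain n where "card V = Suc n"
    using fin r by (cases "card V") auto
  ultimately obtain S and rk :: "'a \<Rightarrow> nat" where S: "S \<subseteq> V" "card S = card V" "inj_on rk S" "rk r = 0"
      "\<forall>y\<in>S - {r}. \<exists>x\<in>S. (x, y) \<in> E \<and> rk x < rk y"
    by (metis lessI)
  then have "S = V"
    using fin card_subset_eq by blast
  then show thesis
    using S(3-5) by (intro that[of rk]) blast+
qed

section \<open>Labelling children by pairs of colors\<close>

text \<open>There are \<open>d\<close> pairs with first component 0 and \<open>d * d - d\<close>
  others. The bounds on \<open>t\<close> say that \<open>t\<close> elements fit into the first group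
  and the remaining ones into the second.\<close>

lemma pair_labelling_exists:
  fixes K :: "'a set"
  assumes "finite K" "t \<le> d" "t \<le> card K" "card K - t \<le> d * d - d"
  shows "\<exists>q :: 'a \<Rightarrow> nat \<times> nat. inj_on q K \<and> q ` K \<subseteq> {..<d} \<times> {..<d} \<and>
    card {y \<in> K. fst (q y) = 0} = t"
proof -
  obtain K0 where K0: "K0 \<subseteq> K" "card K0 = t"
    using assms(3) obtain_subset_with_card_n by metis
  have fin0: "finite K0"
    using K0(1) assms(1) finite_subset by blast
  obtain q0 where q0: "q0 ` K0 \<subseteq> {0::nat} \<times> {..<d}" "inj_on q0 K0"
    using card_le_inj[of K0 "{0::nat} \<times> {..<d}"] fin0 K0(2) assms(2)
    by (auto simp: card_cartesian_product)
  have "card (K - K0) \<le> card ({1..<d} \<times> {..<d})"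
    using K0 fin0 assms(1,4) by (simp add: card_Diff_subset card_cartesian_product diff_mult_distrib)
  then obtain q1 where q1: "q1 ` (K - K0) \<subseteq> {1..<d} \<times> {..<d}" "inj_on q1 (K - K0)"
    using card_le_inj[of "K - K0" "{1..<d} \<times> {..<d}"] assms(1) by auto
  define q where "q y = (if y \<in> K0 then q0 y else q1 y)" for y
  have in0: "q y \<in> {0} \<times> {..<d}" if "y \<in> K0" for y
    using that q0(1) by (auto simp: q_def)
  have in1: "q y \<in> {1..<d} \<times> {..<d}" if "y \<in> K - K0" for y
    using that q1(1) by (auto simp: q_def)
  have zero: "fst (q y) = 0 \<longleftrightarrow> y \<in> K0" if "y \<in> K" for y
    using in0[of y] in1[of y] that by (cases "y \<in> K0") (auto simp: mem_Times_iff)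
  have "{y \<in> K. fst (q y) = 0} = K0"
    using zero K0(1) by auto
  moreover have "inj_on q K"
  proof (rule inj_onI)
    fix x y assume xy: "x \<in> K" "y \<in> K" "q x = q y"
    then have "x \<in> K0 \<longleftrightarrow> y \<in> K0"
      using zero by metis
    then show "x = y"
      using xy q0(2) q1(2) by (auto simp: q_def inj_on_def split: if_splits)
  qed
  moreover have "q y \<in> {..<d} \<times> {..<d}" if "y \<in> K" for y
    using in0[of y] in1[of y] that by (cases "y \<in> K0") (auto simp: mem_Times_iff)
  ultimately show ?thesis
    using K0(2) by blast
qed

text \<open>Naming the difference \<open>d * d - d\<close> turns later inequalities about the square
  into linear arithmetic.\<close>

lemma square_ge_double:
  fixes d :: nat
  assumes "d \<ge> 2"
  obtains D where "d * d = D + d" "d \<le> D"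
proof -
  have "2 * d \<le> d * d"
    using assms by (rule mult_right_mono) simp
  then show thesis
    by (intro that[of "d * d - d"]) linarith+
qed

text \<open>Let \<open>s\<close> be the least number of first components 0 forced by the supply of
  other pairs. As \<open>K\<close> is nonempty and smaller than \<open>d * d\<close>, both
  \<open>s\<close> and \<open>Suc s\<close> can be realized, and at most one of them equals
  \<open>m\<close>.\<close>

lemma pair_labelling_avoiding:
  fixes K :: "'a set"
  assumes "finite K" "K \<noteq> {}" "card K < d * d" "d \<ge> 2"
  shows "\<exists>q :: 'a \<Rightarrow> nat \<times> nat. inj_on q K \<and> q ` K \<subseteq> {..<d} \<times> {..<d} \<and>
    card {y \<in> K. fst (q y) = 0} \<noteq> m"
proof -
  define t where "t = (let s = card K - (d * d - d) in if s = m then Suc s else s)"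
  have "card K > 0"
    using assms by (simp add: card_gt_0_iff)
  moreover obtain D where D: "d * d = D + d" "d \<le> D"
    using square_ge_double[OF assms(4)] .
  ultimately have t: "t \<le> d" "t \<le> card K" "card K - t \<le> d * d - d" "t \<noteq> m"
    using assms(3,4) by (auto simp: t_def Let_def D(1))
  show ?thesis
    using pair_labelling_exists[OF assms(1) t(1-3)] t(4) by auto
qed

section \<open>A total coloring preserved only by the identity\<close>

lemma neighbours_image:
  assumes "bij_betw \<phi> V V" "E \<subseteq> V \<times> V"
    and arc: "\<And>x y. \<lbrakk>x \<in> V; y \<in> V\<rbrakk> \<Longrightarrow> (\<phi> x, \<phi> y) \<in> E \<longleftrightarrow> (x, y) \<in> E"
    and "x \<in> V"
  shows "\<phi> ` (E `` {x}) = E `` {\<phi> x}"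
proof (rule set_eqI)
  have img: "\<phi> ` V = V" and inj: "inj_on \<phi> V"
    using assms(1) by (auto simp: bij_betw_def)
  fix z
  show "z \<in> \<phi> ` (E `` {x}) \<longleftrightarrow> z \<in> E `` {\<phi> x}"
  proof (cases "z \<in> V")
    case True
    then obtain w where w: "w \<in> V" "z = \<phi> w"
      using img by blast
    then show ?thesis
      using arc[OF \<open>x \<in> V\<close> w(1)] inj_onD[OF inj] assms(2) by auto
  next
    case False
    then show ?thesis
      using img assms(2) by auto
  qed
qed

text \<open>Automorphisms preserve the degree and, with the colors, the number \<open>Z\<close> of
  color-0 edges at a vertex; these two numbers single out \<open>r\<close>. Induction along
  \<open>rk\<close> then fixes every other vertex, because siblings differ in their own color or in
  the color of the edge to the parent.\<close>

lemma total_distinguishing_coloring: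
  fixes V :: "'a set" and E :: "('a \<times> 'a) set"
  assumes fin: "finite V" and sub: "E \<subseteq> V \<times> V" and "sym E" and "irrefl E"
    and r: "r \<in> V"
    and conn: "\<And>S. S \<subset> V \<Longrightarrow> r \<in> S \<Longrightarrow> \<exists>x\<in>S. \<exists>y\<in>V - S. (x, y) \<in> E"
    and max: "\<And>x. x \<in> V \<Longrightarrow> card (E `` {x}) \<le> card (E `` {r})"
    and two: "card (E `` {r}) \<ge> 2"
    and d: "card (E `` {r}) \<le> d * d"
  obtains vc :: "'a \<Rightarrow> nat" and ec :: "'a \<Rightarrow> 'a \<Rightarrow> nat"
  where "\<And>x. vc x < d" "\<And>x y. ec x y < d" "\<And>x y. ec x y = ec y x"
    "\<And>\<psi> x. \<lbrakk>bij_betw \<psi> V V; \<And>x y. \<lbrakk>x \<in> V; y \<in> V\<rbrakk> \<Longrightarrow> (\<psi> x, \<psi> y) \<in> E \<longleftrightarrow> (x, y) \<in> E;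
        \<And>x. x \<in> V \<Longrightarrow> vc (\<psi> x) = vc x; \<And>x y. (x, y) \<in> E \<Longrightarrow> ec (\<psi> x) (\<psi> y) = ec x y; x \<in> V\<rbrakk>
      \<Longrightarrow> \<psi> x = x"
proof -
  have sE: "(y, x) \<in> E" if "(x, y) \<in> E" for x y
    using \<open>sym E\<close> that by (rule symD)
  have fE: "finite (E `` A)" for A
    using sub fin by (rule_tac finite_subset[of _ V]) auto
  have d2: "d \<ge> 2"
  proof (rule ccontr)
    assume "\<not> ?thesis"
    then have "d = 0 \<or> d = 1" by linarith
    then show False using two d by auto
  qed
  obtain D where D: "d * d = D + d" "d \<le> D"
    using square_ge_double[OF d2] .
  obtain rk :: "'a \<Rightarrow> nat" where inj: "inj_on rk V" and rk0: "rk r = 0"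
    and earlier: "\<And>y. y \<in> V \<Longrightarrow> y \<noteq> r \<Longrightarrow> \<exists>x\<in>V. (x, y) \<in> E \<and> rk x < rk y"
    using search_order_exists[OF fin r conn] by blast
  \<comment> \<open>Taking the earliest neighbour as parent makes \<open>p\<close> compatible with automorphisms that fix all
    earlier vertices.\<close>
  define p where "p y = (ARG_MIN rk x. (x, y) \<in> E)" for y
  have p_edge: "(p y, y) \<in> E" and p_le: "rk (p y) \<le> rk x" if "(x, y) \<in> E" for x y
    using arg_min_nat_lemma[of "\<lambda>x. (x, y) \<in> E" x rk] that by (auto simp: p_def)
  have p: "(p y, y) \<in> E" "rk (p y) < rk y" if "y \<in> V" "y \<noteq> r" for y
    using earlier[OF that] p_edge p_le by (blast, meson le_less_trans)
  \<comment> \<open>The root is excluded because \<open>p r\<close> is merely some neighbour of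
    \<open>r\<close> and not a parent.\<close>
  define ch where "ch x = {y \<in> V - {r}. p y = x}" for x
  have ch_sub: "ch x \<subseteq> E `` {x}" for x
    using p(1) by (auto simp: ch_def)
  have fch: "finite (ch x)" for x
    using fin by (simp add: ch_def)
  \<comment> \<open>Rank 0 is minimal and \<open>rk\<close> is injective, so \<open>r\<close> is the
    parent of each of its neighbours.\<close>
  have chr: "ch r = E `` {r}"
  proof (rule equalityI[OF ch_sub], rule subsetI)
    fix y assume "y \<in> E `` {r}"
    then have y: "(r, y) \<in> E" by simp
    then have "rk (p y) = rk r" "p y \<in> V" "y \<in> V" "y \<noteq> r"
      using p_le[OF y] p_edge[OF y] rk0 sub \<open>irrefl E\<close> by (auto simp: irrefl_def)
    then show "y \<in> ch r"
      using inj r by (auto simp: ch_def dest: inj_onD)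
  qed
  \<comment> \<open>At most \<open>d * d - d\<close> children of \<open>r\<close> can avoid a label
    with first component 0, so \<open>a\<close> is the least possible number of color-0 edges at
    \<open>r\<close>. The gap of 2 below the degree is what excludes leaves later.\<close>
  define a where "a = card (E `` {r}) - (d * d - d)"
  have a: "a \<le> d" "a + 2 \<le> card (E `` {r})"
    using d two d2 D(2) by (auto simp: a_def D(1))
  \<comment> \<open>\<open>q\<close> labels the children of \<open>x\<close>. The constraint on \<open>q\<close> involves the color of the edge from \<open>x\<close>
    to its parent, hence the labels \<open>h (p x)\<close> chosen earlier.\<close>
  define P where "P h x q \<longleftrightarrow> (x \<in> V \<longrightarrow> inj_on q (ch x) \<and> q ` ch x \<subseteq> {..<d} \<times> {..<d} \<and>
      (if x = r then card {y \<in> ch x. fst (q y) = 0} = a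
       else ch x \<noteq> {} \<longrightarrow> card {y \<in> ch x. fst (q y) = 0} +
         card {y \<in> E `` {x} - ch x. y = p x \<longrightarrow> fst (h (p x) x) = 0} \<noteq> a))"
    for h :: "'a \<Rightarrow> 'a \<Rightarrow> nat \<times> nat" and x q
  \<comment> \<open>Well-founded choice along \<open>rk\<close>: at a vertex other than
    \<open>r\<close>, \<open>P\<close> consults only the labels given out by its parent, which has
    smaller rank.\<close>
  have "\<exists>h. \<forall>x. P h x (h x)"
  proof (rule dependent_wf_choice[of "measure rk"])
    show "wf (measure rk)" by simp
  next
    fix f g :: "'a \<Rightarrow> 'a \<Rightarrow> nat \<times> nat" and x q
    assume "\<And>z. (z, x) \<in> measure rk \<Longrightarrow> f z = g z"
    then have "f (p x) = g (p x)" if "x \<in> V" "x \<noteq> r"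
      using p(2)[OF that] by simp
    then show "P f x q = P g x q"
      unfolding P_def by auto
  next
    fix x and f :: "'a \<Rightarrow> 'a \<Rightarrow> nat \<times> nat"
    show "\<exists>q. P f x q"
    proof (cases "x \<in> V")
      case False
      then show ?thesis by (simp add: P_def)
    next
      case x: True
      consider "x = r" | "x \<noteq> r" "ch x = {}" | "x \<noteq> r" "ch x \<noteq> {}" by blast
      then show ?thesis
      proof cases
        case 1
        have "a \<le> card (ch x)" "card (ch x) - a \<le> d * d - d"
          using a by (auto simp: a_def 1 chr)
        then show ?thesis
          using pair_labelling_exists[OF fch a(1), of x] 1 by (auto simp: P_def)
      next
        case 2
        then show ?thesis by (simp add: P_def)
      next
        case 3
        \<comment> \<open>The parent takes up one neighbour of \<open>x\<close>, which leaves
          strictly fewer than \<open>d * d\<close> children.\<close>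
        have "p x \<in> E `` {x}" "p x \<notin> ch x"
          using p[OF x 3(1)] sE p(2)[of "p x"] by (auto simp: ch_def)
        then have "ch x \<subset> E `` {x}"
          using ch_sub by blast
        then have "card (ch x) < card (E `` {x})"
          by (rule psubset_card_mono[OF fE])
        then have "card (ch x) < d * d"
          using max[OF x] d by linarith
        \<comment> \<open>The value to avoid is a truncated difference: if the edges to non-children
          already contribute more than \<open>a\<close>, the total cannot be \<open>a\<close>
          anyway.\<close>
        from pair_labelling_avoiding[OF fch 3(2) this d2]
        obtain q :: "'a \<Rightarrow> nat \<times> nat" where q:
          "inj_on q (ch x)" "q ` ch x \<subseteq> {..<d} \<times> {..<d}"
          "card {y \<in> ch x. fst (q y) = 0} \<noteq>
             a - card {y \<in> E `` {x} - ch x. y = p x \<longrightarrow> fst (f (p x) x) = 0}"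
          by blast
        have "card {y \<in> ch x. fst (q y) = 0} +
            card {y \<in> E `` {x} - ch x. y = p x \<longrightarrow> fst (f (p x) x) = 0} \<noteq> a"
          using q(3) by linarith
        then have "P f x q"
          using q(1,2) 3(1) unfolding P_def by simp
        then show ?thesis by (rule exI[of _ q])
      qed
    qed
  qed
  then obtain h where h: "\<And>x. P h x (h x)" by blast
  define c where "c y = h (p y) y" for y
  have c_h: "c y = h x y" if "y \<in> ch x" for x y
    using that by (simp add: c_def ch_def)
  have h_inj: "inj_on (h x) (ch x)" and h_ran: "h x ` ch x \<subseteq> {..<d} \<times> {..<d}" if "x \<in> V" for x
    using h[of x] that by (simp_all add: P_def)
  have c_inj: "inj_on c (ch x)" if "x \<in> V" for x
    using inj_on_cong[THEN iffD2, OF c_h h_inj[OF that]] .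
  have c_ran: "fst (c y) < d" "snd (c y) < d" if "y \<in> V" "y \<noteq> r" for y
  proof -
    have "y \<in> ch (p y)" "p y \<in> V"
      using p(1)[OF that] that sub by (auto simp: ch_def)
    then have "c y \<in> {..<d} \<times> {..<d}"
      using h_ran c_h by blast
    then show "fst (c y) < d" "snd (c y) < d"
      by (simp_all add: mem_Times_iff)
  qed
  define vc where "vc x = (if x \<in> V - {r} then snd (c x) else 0)" for x
  \<comment> \<open>The default 0 on non-tree edges is what the count in \<open>P\<close> presumes:
    there, a neighbour that is neither child nor parent always counts.\<close>
  define ec where "ec x y = (if y \<in> ch x then fst (c y) else if x \<in> ch y then fst (c x) else 0)" for x y
  have anti: "\<not> (y \<in> ch x \<and> x \<in> ch y)" for x y
    using p(2) by (auto simp: ch_def) (metis order.asym)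
  define Z where "Z x = card {y \<in> E `` {x}. ec x y = 0}" for x
  have Zr: "Z r = a"
  proof -
    have "{y \<in> E `` {r}. ec r y = 0} = {y \<in> ch r. fst (h r y) = 0}"
      unfolding chr[symmetric] by (rule Collect_cong) (simp add: ec_def c_h cong: conj_cong)
    then show ?thesis
      using h[of r] r by (simp add: P_def Z_def)
  qed
  have Z: "Z x \<noteq> a" if x: "x \<in> V" "x \<noteq> r" "card (E `` {x}) = card (E `` {r})" for x
  proof -
    have px: "p x \<in> E `` {x}" "x \<in> ch (p x)"
      using p[OF x(1,2)] sE x by (auto simp: ch_def)
    have "ec x y = 0 \<longleftrightarrow> (if y \<in> ch x then fst (h x y) = 0 else y = p x \<longrightarrow> fst (h (p x) x) = 0)" for y
      using c_h px(2) by (auto simp: ec_def ch_def)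
    then have split: "{y \<in> E `` {x}. ec x y = 0} = {y \<in> ch x. fst (h x y) = 0} \<union>
        {y \<in> E `` {x} - ch x. y = p x \<longrightarrow> fst (h (p x) x) = 0}"
      using ch_sub[of x] by auto
    have fin_nb: "finite {y \<in> E `` {x} - ch x. Q y}" for Q
      by (rule finite_subset[OF _ fE[of "{x}"]]) blast
    have "Z x = card {y \<in> ch x. fst (h x y) = 0} +
        card {y \<in> E `` {x} - ch x. y = p x \<longrightarrow> fst (h (p x) x) = 0}"
      unfolding Z_def split by (rule card_Un_disjoint) (use fch fin_nb in auto)
    \<comment> \<open>At a leaf of the tree only the edge to the parent can have a nonzero color, so
      for a leaf of full degree \<open>Z x\<close> is at least the degree of \<open>r\<close> minus
      1, hence above \<open>a\<close>.\<close>
    moreover have "card (E `` {x} - {p x}) \<le> Z x" if "ch x = {}"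
      unfolding Z_def split by (rule card_mono) (use that fin_nb in auto)
    moreover have "card (E `` {x} - {p x}) = card (E `` {x}) - 1"
      using px(1) by simp
    ultimately show ?thesis
      using h[of x] x a(2) by (cases "ch x = {}") (auto simp: P_def)
  qed
  show thesis
  proof (rule that[of vc ec])
    show "vc x < d" for x
      using c_ran d2 by (auto simp: vc_def)
    show "ec x y < d" for x y
      using c_ran d2 by (auto simp: ec_def ch_def)
    show "ec x y = ec y x" for x y
      using anti[of x y] by (auto simp: ec_def)
  next
    fix \<psi> x
    assume bij: "bij_betw \<psi> V V"
      and arc: "\<And>x y. \<lbrakk>x \<in> V; y \<in> V\<rbrakk> \<Longrightarrow> (\<psi> x, \<psi> y) \<in> E \<longleftrightarrow> (x, y) \<in> E"
      and vc: "\<And>x. x \<in> V \<Longrightarrow> vc (\<psi> x) = vc x"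
      and ec: "\<And>x y. (x, y) \<in> E \<Longrightarrow> ec (\<psi> x) (\<psi> y) = ec x y"
      and "x \<in> V"
    have inj\<psi>: "inj_on \<psi> V" and img: "\<psi> ` V = V"
      using bij by (auto simp: bij_betw_def)
    have nb: "\<psi> ` (E `` {r}) = E `` {\<psi> r}"
      by (rule neighbours_image[OF bij sub arc r])
    have inj_nb: "inj_on \<psi> (E `` {r})"
      by (rule inj_on_subset[OF inj\<psi>]) (use sub in auto)
    have deg: "card (E `` {\<psi> r}) = card (E `` {r})"
      unfolding nb[symmetric] by (rule card_image[OF inj_nb])
    have "{z \<in> \<psi> ` (E `` {r}). ec (\<psi> r) z = 0} = \<psi> ` {z \<in> E `` {r}. ec r z = 0}"
      using ec by auto
    then have "Z (\<psi> r) = card (\<psi> ` {z \<in> E `` {r}. ec r z = 0})"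
      unfolding Z_def nb by simp
    also have "\<dots> = Z r"
      unfolding Z_def by (rule card_image, rule inj_on_subset[OF inj_nb]) blast
    finally have \<psi>r: "\<psi> r = r"
      using Z[of "\<psi> r"] Zr deg img r by blast
    show "\<psi> x = x"
      using \<open>x \<in> V\<close>
    proof (induction "rk x" arbitrary: x rule: less_induct)
      case less
      show ?case
      proof (cases "x = r")
        case True
        then show ?thesis by (simp add: \<psi>r)
      next
        case False
        note x = less.prems False
        note px = p[OF x]
        have pV: "p x \<in> V" "\<psi> x \<in> V"
          using px(1) sub img x by auto
        have p\<psi>: "\<psi> (p x) = p x"
          using less.hyps px(2) pV(1) by blast
        have nr: "\<psi> x \<noteq> r"
          using \<psi>r inj_onD[OF inj\<psi>, of x r] x r by metis
        have e: "(p x, \<psi> x) \<in> E"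
          using arc[OF pV(1) x(1)] px(1) p\<psi> by simp
        \<comment> \<open>The parent of \<open>\<psi> x\<close> is no later than \<open>p x\<close>,
          hence fixed by induction, hence also adjacent to \<open>x\<close>. Minimality of
          \<open>p x\<close> among the neighbours of \<open>x\<close> gives the reverse
          inequality.\<close>
        have le: "rk (p (\<psi> x)) \<le> rk (p x)" and e': "(p (\<psi> x), \<psi> x) \<in> E"
          using p_le[OF e] p_edge[OF e] by auto
        have q: "p (\<psi> x) \<in> V"
          using e' sub by auto
        then have "\<psi> (p (\<psi> x)) = p (\<psi> x)"
          using less.hyps le px(2) by simp
        then have "(p (\<psi> x), x) \<in> E"
          using arc[OF q x(1)] e' by simp
        then have "rk (p x) \<le> rk (p (\<psi> x))"
          by (rule p_le)
        then have eq: "p (\<psi> x) = p x"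
          using le inj_onD[OF inj _ q pV(1)] by simp
        then have ch: "x \<in> ch (p x)" "\<psi> x \<in> ch (p x)"
          using x nr pV(2) by (auto simp: ch_def)
        \<comment> \<open>\<open>x\<close> and \<open>\<psi> x\<close> are now siblings, and edge
          and vertex colors give the two components of their labels.\<close>
        have "fst (c (\<psi> x)) = fst (c x)"
          using ec[OF px(1)] ch by (simp add: p\<psi> ec_def)
        moreover have "snd (c (\<psi> x)) = snd (c x)"
          using vc[OF x(1)] x nr pV(2) by (simp add: vc_def)
        ultimately show ?thesis
          using inj_onD[OF c_inj[OF pV(1)] _ ch(2,1)] by (simp add: prod_eq_iff)
      qed
    qed
  qed
qed

section \<open>Automorphisms of the central graph\<close>

lemma central_graph_simps:
  "Orig u \<in> pverts (central_graph G) \<longleftrightarrow> u \<in> pverts G"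
  "Mid e \<in> pverts (central_graph G) \<longleftrightarrow> (\<exists>u v. e = {u, v} \<and> (u, v) \<in> parcs G)"
  "(Orig u, Orig v) \<in> parcs (central_graph G) \<longleftrightarrow>
     u \<in> pverts G \<and> v \<in> pverts G \<and> u \<noteq> v \<and> (u, v) \<notin> parcs G"
  "(Orig u, Mid e) \<in> parcs (central_graph G) \<longleftrightarrow> (\<exists>v. e = {u, v} \<and> (u, v) \<in> parcs G)"
  "(Mid e, Orig v) \<in> parcs (central_graph G) \<longleftrightarrow> (\<exists>u. e = {u, v} \<and> (u, v) \<in> parcs G)"
  "(Mid e, Mid e') \<notin> parcs (central_graph G)"
  by (auto simp: central_graph_def)

lemma pair_graph_parcs:
  assumes "pair_graph G"
  shows "finite (pverts G)" "parcs G \<subseteq> pverts G \<times> pverts G" "sym (parcs G)" "irrefl (parcs G)"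
proof -
  interpret pair_graph G by fact
  show "finite (pverts G)" by (rule pair_finite_verts)
  show "parcs G \<subseteq> pverts G \<times> pverts G" by (auto dest: in_arcsD1 in_arcsD2)
  show "sym (parcs G)" using pair_sym_arcs by (simp add: symmetric_def)
  show "irrefl (parcs G)" using pair_no_loops by (intro irreflI) force
qed

text \<open>Every \<open>v\<close> other than \<open>u\<close> accounts for exactly one neighbour of
  \<open>Orig u\<close>: \<open>Mid {u, v}\<close> if \<open>u\<close> and \<open>v\<close> are
  adjacent in \<open>G\<close>, and \<open>Orig v\<close> otherwise. A new vertex is adjacent to the
  ends of its edge only.\<close>

lemma card_central_graph_neighbours:
  assumes "pair_graph G"
  shows "u \<in> pverts G \<Longrightarrow> card (parcs (central_graph G) `` {Orig u}) = card (pverts G) - 1"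
    and "Mid e \<in> pverts (central_graph G) \<Longrightarrow> card (parcs (central_graph G) `` {Mid e}) \<le> 2"
proof -
  note G = pair_graph_parcs[OF assms]
  show "card (parcs (central_graph G) `` {Orig u}) = card (pverts G) - 1" if u: "u \<in> pverts G"
  proof -
    let ?f = "\<lambda>v. if (u, v) \<in> parcs G then Mid {u, v} else Orig v"
    have "parcs (central_graph G) `` {Orig u} = ?f ` (pverts G - {u})"
    proof (rule set_eqI)
      fix z
      show "z \<in> parcs (central_graph G) `` {Orig u} \<longleftrightarrow> z \<in> ?f ` (pverts G - {u})"
        using u G(2,4) by (cases z) (auto simp: central_graph_simps irrefl_def image_iff)
    qed
    moreover have "inj_on ?f (pverts G - {u})"
      by (auto simp: inj_on_def doubleton_eq_iff split: if_splits)
    ultimately have "card (parcs (central_graph G) `` {Orig u}) = card (pverts G - {u})"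
      by (simp only: card_image)
    then show ?thesis
      using u by simp
  qed
  show "card (parcs (central_graph G) `` {Mid e}) \<le> 2" if "Mid e \<in> pverts (central_graph G)"
  proof -
    obtain u v where "e = {u, v}"
      using \<open>Mid e \<in> _\<close> by (auto simp: central_graph_simps)
    have "parcs (central_graph G) `` {Mid e} \<subseteq> {Orig u, Orig v}"
    proof
      fix z
      assume "z \<in> parcs (central_graph G) `` {Mid e}"
      then show "z \<in> {Orig u, Orig v}"
        using \<open>e = {u, v}\<close> by (cases z) (auto simp: central_graph_simps doubleton_eq_iff)
    qed
    then have "card (parcs (central_graph G) `` {Mid e}) \<le> card {Orig u, Orig v}"
      by (intro card_mono) auto
    also have "\<dots> \<le> 2"
      by (simp add: card_insert_if)
    finally show ?thesis .
  qed
qed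

text \<open>Degrees at least 3 and at most 2 keep original and new vertices apart. On original
  vertices \<open>central_graph G\<close> is the complement of \<open>G\<close>, so the induced map
  respects \<open>G\<close>; a new vertex is determined by its two neighbours.\<close>

lemma central_graph_automorphism:
  assumes G: "pair_graph G" and "card (pverts G) \<ge> 4"
    and aut: "automorphism (central_graph G) \<phi>"
  obtains \<psi> where "bij_betw \<psi> (pverts G) (pverts G)"
    "\<And>u v. \<lbrakk>u \<in> pverts G; v \<in> pverts G\<rbrakk> \<Longrightarrow> (\<psi> u, \<psi> v) \<in> parcs G \<longleftrightarrow> (u, v) \<in> parcs G"
    "\<And>u. u \<in> pverts G \<Longrightarrow> \<phi> (Orig u) = Orig (\<psi> u)"
    "\<And>u v. (u, v) \<in> parcs G \<Longrightarrow> \<phi> (Mid {u, v}) = Mid {\<psi> u, \<psi> v}"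
proof -
  let ?V = "pverts G" and ?E = "parcs G"
  let ?W = "pverts (central_graph G)" and ?A = "parcs (central_graph G)"
  note E = pair_graph_parcs[OF G] and A = pair_graph_parcs[OF pair_graph_central_graph[OF G]]
  have bij: "bij_betw \<phi> ?W ?W"
    and arc: "\<And>x y. \<lbrakk>x \<in> ?W; y \<in> ?W\<rbrakk> \<Longrightarrow> (\<phi> x, \<phi> y) \<in> ?A \<longleftrightarrow> (x, y) \<in> ?A"
    using aut by (auto simp: automorphism_def)
  have inj: "inj_on \<phi> ?W" and img: "\<And>x. x \<in> ?W \<Longrightarrow> \<phi> x \<in> ?W"
    using bij by (auto simp: bij_betw_def)
  have deg: "card (?A `` {\<phi> x}) = card (?A `` {x})" if "x \<in> ?W" for x
  proof -
    have "card (\<phi> ` (?A `` {x})) = card (?A `` {x})"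
      by (rule card_image, rule inj_on_subset[OF inj]) (use A(2) in auto)
    then show ?thesis
      using neighbours_image[OF bij A(2) arc that] by simp
  qed
  have orig: "\<exists>v \<in> ?V. \<phi> (Orig u) = Orig v" if u: "u \<in> ?V" for u
  proof (cases "\<phi> (Orig u)")
    case (Orig v)
    have "Orig u \<in> ?W"
      using u by (simp add: central_graph_simps)
    then show ?thesis
      using img[of "Orig u"] Orig by (simp add: central_graph_simps)
  next
    case (Mid e)
    have W: "Orig u \<in> ?W"
      using u by (simp add: central_graph_simps)
    then have "Mid e \<in> ?W"
      using img[of "Orig u"] Mid by simp
    then have "card (pverts G) - 1 \<le> 2"
      using card_central_graph_neighbours(2)[OF G] card_central_graph_neighbours(1)[OF G u]
        deg[OF W] Mid by metis
    then show ?thesis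
      using assms(2) by linarith
  qed
  have mid: "\<exists>e. \<phi> (Mid e') = Mid e" if W: "Mid e' \<in> ?W" for e'
  proof (cases "\<phi> (Mid e')")
    case (Orig v)
    then have "v \<in> ?V"
      using img[OF W] by (simp add: central_graph_simps)
    then have "card (pverts G) - 1 \<le> 2"
      using card_central_graph_neighbours(2)[OF G W] card_central_graph_neighbours(1)[OF G, of v]
        deg[OF W] Orig by metis
    then show ?thesis
      using assms(2) by linarith
  qed simp
  define \<psi> where "\<psi> u = (THE v. \<phi> (Orig u) = Orig v)" for u
  have \<psi>: "\<phi> (Orig u) = Orig (\<psi> u)" "\<psi> u \<in> ?V" if "u \<in> ?V" for u
    using orig[OF that] by (auto simp: \<psi>_def)
  have inj\<psi>: "inj_on \<psi> ?V"
  proof (rule inj_onI)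
    fix u v assume uv: "u \<in> ?V" "v \<in> ?V" "\<psi> u = \<psi> v"
    then have "\<phi> (Orig u) = \<phi> (Orig v)"
      using \<psi>(1) by metis
    then have "Orig u = Orig v"
      by (rule inj_onD[OF inj]) (use uv(1,2) in \<open>simp_all add: central_graph_simps(1)\<close>)
    then show "u = v" by simp
  qed
  have bij\<psi>: "bij_betw \<psi> ?V ?V"
    unfolding bij_betw_def using inj\<psi> \<psi>(2) endo_inj_surj[OF E(1) _ inj\<psi>] by blast
  \<comment> \<open>The complement description covers distinct vertices only; for equal ones both
    sides fail, as \<open>G\<close> has no loops.\<close>
  have arc\<psi>: "(\<psi> u, \<psi> v) \<in> ?E \<longleftrightarrow> (u, v) \<in> ?E" if "u \<in> ?V" "v \<in> ?V" for u v
  proof (cases "u = v")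
    case True
    then show ?thesis using E(4) by (auto simp: irrefl_def)
  next
    case False
    then have "\<psi> u \<noteq> \<psi> v"
      using inj\<psi> that by (auto dest: inj_onD)
    then show ?thesis
      using arc[of "Orig u" "Orig v"] that False \<psi> by (simp add: central_graph_simps)
  qed
  have "\<phi> (Mid {u, v}) = Mid {\<psi> u, \<psi> v}" if uv: "(u, v) \<in> ?E" for u v
  proof -
    have V: "u \<in> ?V" "v \<in> ?V" "u \<noteq> v"
      using uv E(2,4) by (auto simp: irrefl_def)
    have W: "Mid {u, v} \<in> ?W"
      using uv by (auto simp: central_graph_simps)
    have "(Orig u, Mid {u, v}) \<in> ?A" "(Orig v, Mid {u, v}) \<in> ?A"
      using uv symD[OF E(3) uv] by (auto simp: central_graph_simps insert_commute)
    then have *: "(Orig (\<psi> u), \<phi> (Mid {u, v})) \<in> ?A" "(Orig (\<psi> v), \<phi> (Mid {u, v})) \<in> ?A"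
      using arc[OF _ W, of "Orig u"] arc[OF _ W, of "Orig v"] V \<psi>
      by (simp_all add: central_graph_simps(1))
    obtain e where e: "\<phi> (Mid {u, v}) = Mid e"
      using mid[OF W] by blast
    \<comment> \<open>A new vertex adjacent to two distinct original vertices is indexed by exactly
      that pair.\<close>
    have "\<psi> u \<noteq> \<psi> v"
      using inj\<psi> V by (auto dest: inj_onD)
    then show ?thesis
      using * e by (auto simp: central_graph_simps doubleton_eq_iff)
  qed
  then show thesis
    using that[OF bij\<psi> arc\<psi> \<psi>(1)] by blast
qed

section \<open>From total colorings of the graph to colorings of its central graph\<close>

text \<open>Symmetry makes the value independent of the order of the ends; this carries edge colors
  over to the vertices \<open>Mid e\<close>, which are indexed by sets.\<close>

lemma symmetric_function_on_doubletons:
  assumes "\<And>x y. f x y = f y x"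
  obtains g where "\<And>x y. g {x, y} = f x y"
proof
  fix x y
  have "(\<exists>x' y'. {x, y} = {x', y'} \<and> c = f x' y') \<longleftrightarrow> c = f x y" for c
    using assms by (metis doubleton_eq_iff)
  then show "(\<lambda>e. SOME c. \<exists>x y. e = {x, y} \<and> c = f x y) {x, y} = f x y"
    by simp
qed

text \<open>Original vertices take their color from \<open>vc\<close>, new ones from
  \<open>ec\<close>. A color-preserving automorphism then induces one of \<open>G\<close> that
  preserves the total coloring, so it fixes all original vertices and with them the new
  ones.\<close>

lemma central_graph_distinguishing_coloring:
  assumes "pair_graph G" and "card (pverts G) \<ge> 4" and d: "\<And>x. vc x < d" "\<And>x y. ec x y < d"
    and sym: "\<And>x y. ec x y = ec y x"
    and dist: "\<And>\<psi> x. \<lbrakk>bij_betw \<psi> (pverts G) (pverts G);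
        \<And>x y. \<lbrakk>x \<in> pverts G; y \<in> pverts G\<rbrakk> \<Longrightarrow> (\<psi> x, \<psi> y) \<in> parcs G \<longleftrightarrow> (x, y) \<in> parcs G;
        \<And>x. x \<in> pverts G \<Longrightarrow> vc (\<psi> x) = vc x;
        \<And>x y. (x, y) \<in> parcs G \<Longrightarrow> ec (\<psi> x) (\<psi> y) = ec x y; x \<in> pverts G\<rbrakk> \<Longrightarrow> \<psi> x = x"
  shows "\<exists>f. distinguishing_coloring (central_graph G) d f"
proof -
  note E = pair_graph_parcs[OF assms(1)]
  obtain g where g: "\<And>x y. g {x, y} = ec x y"
    using symmetric_function_on_doubletons[of ec] sym by blast
  define f where "f z = (case z of Orig u \<Rightarrow> vc u | Mid e \<Rightarrow> g e)" for z
  have "\<phi> z = z" if aut: "automorphism (central_graph G) \<phi>"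
    and pres: "preserves_coloring (central_graph G) f \<phi>"
    and z: "z \<in> pverts (central_graph G)" for \<phi> z
  proof -
    obtain \<psi> where \<psi>: "bij_betw \<psi> (pverts G) (pverts G)"
      "\<And>u v. \<lbrakk>u \<in> pverts G; v \<in> pverts G\<rbrakk> \<Longrightarrow> (\<psi> u, \<psi> v) \<in> parcs G \<longleftrightarrow> (u, v) \<in> parcs G"
      "\<And>u. u \<in> pverts G \<Longrightarrow> \<phi> (Orig u) = Orig (\<psi> u)"
      "\<And>u v. (u, v) \<in> parcs G \<Longrightarrow> \<phi> (Mid {u, v}) = Mid {\<psi> u, \<psi> v}"
      using central_graph_automorphism[OF assms(1,2) aut] by blast
    have pres: "f (\<phi> x) = f x" if "x \<in> pverts (central_graph G)" for x
      using pres that by (simp add: preserves_coloring_def)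
    have "vc (\<psi> x) = vc x" if "x \<in> pverts G" for x
      using pres[of "Orig x"] \<psi>(3) that by (simp add: f_def central_graph_simps)
    moreover have "ec (\<psi> x) (\<psi> y) = ec x y" if xy: "(x, y) \<in> parcs G" for x y
    proof -
      have "Mid {x, y} \<in> pverts (central_graph G)"
        using xy by (auto simp: central_graph_simps)
      then show ?thesis
        using pres[of "Mid {x, y}"] \<psi>(4)[OF xy] by (simp add: f_def g)
    qed
    ultimately have id: "\<psi> x = x" if "x \<in> pverts G" for x
      using dist[OF \<psi>(1,2)] that by blast
    show "\<phi> z = z"
    proof (cases z)
      case (Orig u)
      then show ?thesis
        using z \<psi>(3) id by (simp add: central_graph_simps)
    next
      case (Mid e)
      then obtain u v where "e = {u, v}" "(u, v) \<in> parcs G"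
        using z by (auto simp: central_graph_simps)
      moreover from this(2) have "u \<in> pverts G" "v \<in> pverts G"
        using E(2) by auto
      ultimately show ?thesis
        using Mid \<psi>(4) id by simp
    qed
  qed
  moreover have "f z < d" if "z \<in> pverts (central_graph G)" for z
    using that d by (cases z) (auto simp: f_def central_graph_simps g)
  ultimately have "distinguishing_coloring (central_graph G) d f"
    by (simp add: distinguishing_coloring_def)
  then show ?thesis by blast
qed

section \<open>Connectedness and maximum degree\<close>

text \<open>If no arc left \<open>S\<close>, then \<open>S\<close> would be closed under
  reachability and contain every vertex.\<close>

lemma connected_leaving_arc:
  assumes "pair_graph G" "Digraph_Component.connected (with_proj G)" "S \<subset> pverts G" "r \<in> S"
  shows "\<exists>x\<in>S. \<exists>y\<in>pverts G - S. (x, y) \<in> parcs G"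
proof (rule ccontr)
  interpret pair_graph G by fact
  assume no: "\<not> ?thesis"
  obtain t where t: "t \<in> pverts G" "t \<notin> S"
    using assms(3) by blast
  \<comment> \<open>Connectedness is strong connectedness of the symmetric closure, whose
    reachability agrees with that of \<open>G\<close> because the arcs are symmetric.\<close>
  have "r \<rightarrow>\<^sup>*\<^bsub>mk_symmetric (with_proj G)\<^esub> t"
    using assms t by (auto simp: connected_def strongly_connected_def)
  then have "r \<rightarrow>\<^sup>*\<^bsub>with_proj G\<^esub> t"
    using reachable_mk_symmetric_eq[OF sym_arcs] by simp
  then have "t \<in> S"
  proof (induction rule: reachable_induct)
    case base
    then show ?case using assms(4) by simp
  next
    case (step x y)
    then show ?case
      using no in_arcsD2[of x y] by (simp add: arcs_ends_def arc_to_ends_def) blast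
  qed
  then show False
    using t(2) by simp
qed

lemma max_degree_vertex:
  assumes "pair_graph G" "pverts G \<noteq> {}"
  obtains r where "r \<in> pverts G" "card (parcs G `` {r}) = max_degree G"
    "\<And>x. x \<in> pverts G \<Longrightarrow> card (parcs G `` {x}) \<le> max_degree G"
proof -
  note E = pair_graph_parcs[OF assms(1)]
  have deg: "out_degree (with_proj G) x = card (parcs G `` {x})" for x
  proof -
    have "out_arcs (with_proj G) x = Pair x ` (parcs G `` {x})"
      by (auto simp: out_arcs_def)
    then show ?thesis
      by (simp add: out_degree_def card_image inj_on_def)
  qed
  let ?D = "out_degree (with_proj G) ` pverts G"
  have "finite ?D" "?D \<noteq> {}"
    using E(1) assms(2) by auto
  then have "max_degree G \<in> ?D"
    unfolding max_degree_def by (rule Max_in)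
  then obtain r where "r \<in> pverts G" "max_degree G = card (parcs G `` {r})"
    unfolding deg by blast
  moreover have "card (parcs G `` {x}) \<le> max_degree G" if "x \<in> pverts G" for x
    unfolding max_degree_def deg using that E(1) by simp
  ultimately show thesis
    using that by metis
qed

text \<open>If all degrees were at most 1, then \<open>r\<close> and its only neighbour
  \<open>s\<close> would form a component, contradicting the edge that must leave
  \<open>{r, s}\<close>.\<close>

lemma max_degree_ge_2:
  assumes "pair_graph G" "Digraph_Component.connected (with_proj G)" "card (pverts G) > 2"
  shows "max_degree G \<ge> 2"
proof (rule ccontr)
  note E = pair_graph_parcs[OF assms(1)]
  assume no: "\<not> ?thesis"
  have "pverts G \<noteq> {}"
    using assms(3) by auto
  then obtain r where r: "r \<in> pverts G"
    and max: "\<And>x. x \<in> pverts G \<Longrightarrow> card (parcs G `` {x}) \<le> max_degree G"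
    using max_degree_vertex[OF assms(1)] by metis
  have fin: "finite (parcs G `` {x})" for x
    using E(1,2) by (rule_tac finite_subset[of _ "pverts G"]) auto
  have one: "y = z" if "(x, y) \<in> parcs G" "(x, z) \<in> parcs G" for x y z
  proof -
    have "x \<in> pverts G"
      using that E(2) by blast
    then have "card (parcs G `` {x}) \<le> Suc 0"
      using no max[of x] by linarith
    then show ?thesis
      using that card_le_Suc0_iff_eq[OF fin] by blast
  qed
  have proper: "S \<subset> pverts G" if "S \<subseteq> pverts G" "card S \<le> 2" for S
    using that assms(3) by auto
  have leaving: "\<exists>x\<in>S. \<exists>y\<in>pverts G - S. (x, y) \<in> parcs G"
    if "S \<subseteq> pverts G" "card S \<le> 2" "r \<in> S" for S
    using connected_leaving_arc[OF assms(1,2) proper that(3)] that(1,2) by blast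
  obtain s where s: "s \<in> pverts G" "s \<noteq> r" "(r, s) \<in> parcs G"
    using leaving[of "{r}"] r by auto
  obtain x y where "x \<in> {r, s}" "y \<notin> {r, s}" "(x, y) \<in> parcs G"
    using leaving[of "{r, s}"] r s(1,2) by auto
  then show False
    using one s(3) symD[OF E(3) s(3)] by blast
qed

section \<open>The bound on the distinguishing number\<close>

theorem theorem3p4:
  fixes G :: "'a pair_pre_digraph"
  assumes "pair_graph G"
    and "Digraph_Component.connected (with_proj G)"
    and "card (pverts G) \<ge> 4"
  shows "int (distinguishing_number (central_graph G)) \<le> \<lceil>sqrt (real (max_degree G))\<rceil>"
proof -
  note E = pair_graph_parcs[OF assms(1)]
  define d where "d = nat \<lceil>sqrt (real (max_degree G))\<rceil>"
  have "pverts G \<noteq> {}"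
    using assms(3) by auto
  then obtain r where r: "r \<in> pverts G" and deg: "card (parcs G `` {r}) = max_degree G"
    and max: "\<And>x. x \<in> pverts G \<Longrightarrow> card (parcs G `` {x}) \<le> max_degree G"
    using max_degree_vertex[OF assms(1)] by metis
  have "sqrt (real (max_degree G)) \<le> real d"
    unfolding d_def by (rule real_nat_ceiling_ge)
  then have "real (max_degree G) \<le> (real d)\<^sup>2"
    by (rule sqrt_le_D)
  then have sq: "max_degree G \<le> d * d"
    by (simp add: power2_eq_square flip: of_nat_mult)
  have two: "max_degree G \<ge> 2"
    using max_degree_ge_2[OF assms(1,2)] assms(3) by simp
  have "\<exists>f. distinguishing_coloring (central_graph G) d f"
  proof (rule total_distinguishing_coloring[OF E r, where d = d])
    show "\<exists>x\<in>S. \<exists>y\<in>pverts G - S. (x, y) \<in> parcs G" if "S \<subset> pverts G" "r \<in> S" for S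
      by (rule connected_leaving_arc[OF assms(1,2) that])
    show "card (parcs G `` {x}) \<le> card (parcs G `` {r})" if "x \<in> pverts G" for x
      using max[OF that] deg by simp
    show "2 \<le> card (parcs G `` {r})" "card (parcs G `` {r}) \<le> d * d"
      using two sq deg by simp_all
  next
    fix vc :: "'a \<Rightarrow> nat" and ec
    assume c: "\<And>x. vc x < d" "\<And>x y. ec x y < d" "\<And>x y. ec x y = ec y x"
      and dist: "\<And>\<psi> x. \<lbrakk>bij_betw \<psi> (pverts G) (pverts G);
          \<And>x y. \<lbrakk>x \<in> pverts G; y \<in> pverts G\<rbrakk> \<Longrightarrow> (\<psi> x, \<psi> y) \<in> parcs G \<longleftrightarrow> (x, y) \<in> parcs G;
          \<And>x. x \<in> pverts G \<Longrightarrow> vc (\<psi> x) = vc x;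
          \<And>x y. (x, y) \<in> parcs G \<Longrightarrow> ec (\<psi> x) (\<psi> y) = ec x y; x \<in> pverts G\<rbrakk> \<Longrightarrow> \<psi> x = x"
    show "\<exists>f. distinguishing_coloring (central_graph G) d f"
      by (rule central_graph_distinguishing_coloring[of G vc d ec]) (fact assms c dist)+
  qed
  then have "distinguishing_number (central_graph G) \<le> d"
    unfolding distinguishing_number_def by (rule Least_le)
  \<comment> \<open>The ceiling is nonnegative, so converting it to a natural number loses
    nothing.\<close>
  moreover have "-1 < sqrt (real (max_degree G))"
    using real_sqrt_ge_zero[of "real (max_degree G)"] by linarith
  then have "int d = \<lceil>sqrt (real (max_degree G))\<rceil>"
    unfolding d_def by simp
  ultimately show ?thesis
    by simp
qed

end
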